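(* Any root system in three dimensions gives rise to a spinor group $G$ which induces a root system in four dimensions. That is, if $\Phi_3$ is a root system in 3-dimensional Euclidean space, with root vectors normalised to unit length, and $G\subset\mathrm{Cl}(3)$ is the group of all products of even numbers of root vectors of $\Phi_3$ under the geometric product, then $G$, regarded as a set of vectors in the 4-dimensional space of $\mathrm{Cl}(3)$-spinors with the inner product $(R_1,R_2)=\frac12(R_1\tilde R_2+R_2\tilde R_1)$, is a root system.
   Context: $\mathrm{Cl}(3)$ is the real Clifford algebra generated by orthonormal vectors $e_1,e_2,e_3$ of 3-dimensional Euclidean space with $e_i^2=1$, $e_ie_j=-e_je_i$ for $i\neq j$; its multiplication is called the geometric product. The space of $\mathrm{Cl}(3)$-spinors is the even part, consisting of the elements $R=a_0+a_1e_2e_3+a_2e_3e_1+a_3e_1e_2$ with $a_i\in\mathbb{R}$. The tilde denotes reversal (reversing the order of vector factors in each product), so that $R\tilde R=a_0^2+a_1^2+a_2^2+a_3^2$ and $(R_1,R_2)=\frac12(R_1\tilde R_2+R_2\tilde R_1)$ is a 4D Euclidean inner product on the spinors. Root system: a collection $\Phi$ of non-zero vectors (roots) spanning an $n$-dimensional Euclidean vector space $V$ with positive definite bilinear form $(\cdot|\cdot)$ such that (1) $\Phi\cap\mathbb{R}\alpha=\{\alpha,-\alpha\}$ for all $\alpha\in\Phi$, and (2) $s_\alpha\Phi=\Phi$ for all $\alpha\in\Phi$, where $s_\alpha(\lambda)=\lambda-2\frac{(\lambda|\alpha)}{(\alpha|\alpha)}\alpha$. (No crystallographic condition is imposed.)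 *)

theory Defs
  imports "HOL-Analysis.Analysis" "HOL-Algebra.Group"
begin

section \<open>Root systems\<close>

text \<open>The form \<open>B\<close> is only constrained on \<open>V\<close>, so that \<open>V\<close> may be a proper subspace of
  the ambient type.\<close>

definition euclidean_form_on :: "nat \<Rightarrow> 'a::real_vector set \<Rightarrow> ('a \<Rightarrow> 'a \<Rightarrow> real) \<Rightarrow> bool" where
  "euclidean_form_on n V B \<longleftrightarrow>
     (\<exists>b. finite b \<and> independent b \<and> card b = n \<and> span b = V) \<and>
     (\<forall>x\<in>V. \<forall>y\<in>V. \<forall>z\<in>V. B (x + y) z = B x z + B y z) \<and>
     (\<forall>c. \<forall>x\<in>V. \<forall>y\<in>V. B (c *\<^sub>R x) y = c * B x y) \<and>
     (\<forall>x\<in>V. \<forall>y\<in>V. B x y = B y x) \<and>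
     (\<forall>x\<in>V. x \<noteq> 0 \<longrightarrow> B x x > 0)"

definition root_reflection :: "('a \<Rightarrow> 'a \<Rightarrow> real) \<Rightarrow> 'a \<Rightarrow> 'a \<Rightarrow> 'a::real_vector" where
  "root_reflection B \<alpha> x = x - (2 * (B x \<alpha> / B \<alpha> \<alpha>)) *\<^sub>R \<alpha>"

text \<open>Neither finiteness of \<open>\<Phi>\<close> nor a crystallographic condition is imposed.\<close>

definition root_system ::
  "nat \<Rightarrow> 'a::real_vector set \<Rightarrow> ('a \<Rightarrow> 'a \<Rightarrow> real) \<Rightarrow> 'a set \<Rightarrow> bool" where
  "root_system n V B \<Phi> \<longleftrightarrow>
     euclidean_form_on n V B \<and> 0 \<notin> \<Phi> \<and> span \<Phi> = V \<and>
     (\<forall>\<alpha>\<in>\<Phi>. \<Phi> \<inter> range (\<lambda>c. c *\<^sub>R \<alpha>) = {\<alpha>, - \<alpha>}) \<and>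
     (\<forall>\<alpha>\<in>\<Phi>. root_reflection B \<alpha> ` \<Phi> = \<Phi>)"

text \<open>Normalising the roots of a root system to unit length yields a root system again, so the
  hypothesis that all roots have length \<open>1\<close> costs no generality.\<close>

lemma root_system_normalise:
  fixes \<Phi> :: "'a::real_inner set"
  assumes "root_system n V (\<bullet>) \<Phi>"
  shows "root_system n V (\<bullet>) (sgn ` \<Phi>)"
proof -
  have nz: "0 \<notin> \<Phi>" and sp: "span \<Phi> = V"
    and ray: "\<And>\<alpha>. \<alpha> \<in> \<Phi> \<Longrightarrow> \<Phi> \<inter> range (\<lambda>c. c *\<^sub>R \<alpha>) = {\<alpha>, - \<alpha>}"
    and refl: "\<And>\<alpha>. \<alpha> \<in> \<Phi> \<Longrightarrow> root_reflection (\<bullet>) \<alpha> ` \<Phi> = \<Phi>"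
    using assms by (auto simp: root_system_def)
  have ne: "\<alpha> \<noteq> 0" if "\<alpha> \<in> \<Phi>" for \<alpha> using nz that by auto
  have "span (sgn ` \<Phi>) = V"
  proof
    show "span (sgn ` \<Phi>) \<subseteq> V"
      unfolding sp[symmetric]
      by (intro span_minimal subspace_span) (auto simp: sgn_div_norm intro: span_scale span_base)
    have "\<alpha> \<in> span (sgn ` \<Phi>)" if "\<alpha> \<in> \<Phi>" for \<alpha>
    proof -
      have "\<alpha> = norm \<alpha> *\<^sub>R sgn \<alpha>" using ne[OF that] by (simp add: sgn_div_norm)
      thus ?thesis using that by (metis imageI span_base span_scale)
    qed
    thus "V \<subseteq> span (sgn ` \<Phi>)"
      unfolding sp[symmetric] by (intro span_minimal subspace_span) auto
  qed
  moreover have "sgn ` \<Phi> \<inter> range (\<lambda>c. c *\<^sub>R sgn \<alpha>) = {sgn \<alpha>, - sgn \<alpha>}" if \<alpha>: "\<alpha> \<in> \<Phi>" for \<alpha>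
  proof
    show "sgn ` \<Phi> \<inter> range (\<lambda>c. c *\<^sub>R sgn \<alpha>) \<subseteq> {sgn \<alpha>, - sgn \<alpha>}"
    proof
      fix x assume "x \<in> sgn ` \<Phi> \<inter> range (\<lambda>c. c *\<^sub>R sgn \<alpha>)"
      then obtain \<beta> c where \<beta>: "\<beta> \<in> \<Phi>" "x = sgn \<beta>" "sgn \<beta> = c *\<^sub>R sgn \<alpha>" by auto
      have "\<beta> = norm \<beta> *\<^sub>R sgn \<beta>" using ne[OF \<beta>(1)] by (simp add: sgn_div_norm)
      also have "\<dots> = (norm \<beta> * c / norm \<alpha>) *\<^sub>R \<alpha>"
        by (simp add: \<beta>(3)) (simp add: sgn_div_norm divide_inverse)
      finally have "\<beta> \<in> range (\<lambda>c. c *\<^sub>R \<alpha>)" by blast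
      hence "\<beta> = \<alpha> \<or> \<beta> = - \<alpha>" using ray[OF \<alpha>] \<beta>(1) by blast
      thus "x \<in> {sgn \<alpha>, - sgn \<alpha>}" using \<beta>(2) by (auto simp: sgn_minus)
    qed
    have "- \<alpha> \<in> \<Phi>" using ray[OF \<alpha>] by blast
    hence "- sgn \<alpha> \<in> sgn ` \<Phi>" by (metis imageI sgn_minus)
    moreover have "- sgn \<alpha> = (- 1) *\<^sub>R sgn \<alpha>" "sgn \<alpha> = 1 *\<^sub>R sgn \<alpha>" by simp_all
    ultimately show "{sgn \<alpha>, - sgn \<alpha>} \<subseteq> sgn ` \<Phi> \<inter> range (\<lambda>c. c *\<^sub>R sgn \<alpha>)"
      using \<alpha> by blast
  qed
  moreover have "root_reflection (\<bullet>) (sgn \<alpha>) ` sgn ` \<Phi> = sgn ` \<Phi>" if \<alpha>: "\<alpha> \<in> \<Phi>" for \<alpha>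
  proof -
    have "root_reflection (\<bullet>) (sgn \<alpha>) (sgn x) = sgn (root_reflection (\<bullet>) \<alpha> x)" for x
    proof -
      have "(norm (root_reflection (\<bullet>) \<alpha> x))\<^sup>2 = (norm x)\<^sup>2"
        using ne[OF \<alpha>]
        by (simp add: root_reflection_def power2_norm_eq_inner inner_diff_left inner_diff_right
            inner_commute[of \<alpha> x])
      hence "norm (root_reflection (\<bullet>) \<alpha> x) = norm x" by (simp add: power2_eq_iff_nonneg)
      thus ?thesis using ne[OF \<alpha>]
        by (simp add: sgn_div_norm root_reflection_def algebra_simps power2_norm_eq_inner[symmetric]
            power2_eq_square divide_simps)
    qed
    hence "root_reflection (\<bullet>) (sgn \<alpha>) ` sgn ` \<Phi> = sgn ` root_reflection (\<bullet>) \<alpha> ` \<Phi>"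
      by (simp add: image_image)
    thus ?thesis by (simp add: refl[OF \<alpha>])
  qed
  ultimately show ?thesis
    using assms nz by (auto simp: root_system_def sgn_zero_iff)
qed

section \<open>The Clifford algebra of three-dimensional Euclidean space\<close>

text \<open>A multivector is stored by its coordinates with respect to the basis
  \<open>1, e\<^sub>1, e\<^sub>2, e\<^sub>3, e\<^sub>2e\<^sub>3, e\<^sub>3e\<^sub>1, e\<^sub>1e\<^sub>2, e\<^sub>1e\<^sub>2e\<^sub>3\<close>. The product below is the bilinear extension of the
  products of these blades; it is characterised by the instance \<open>real_algebra_1\<close> together with
  \<open>cl3_generators\<close> and \<open>cl3_expand\<close>.\<close>

codatatype cl3 = Cl3
  (co0: real) (co1: real) (co2: real) (co3: real)
  (co23: real) (co31: real) (co12: real) (co123: real)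

lemma cl3_eq_iff:
  "x = y \<longleftrightarrow> co0 x = co0 y \<and> co1 x = co1 y \<and> co2 x = co2 y \<and> co3 x = co3 y \<and>
     co23 x = co23 y \<and> co31 x = co31 y \<and> co12 x = co12 y \<and> co123 x = co123 y"
  by (auto intro: cl3.expand)

instantiation cl3 :: real_algebra_1
begin

primcorec zero_cl3 where
  "co0 0 = 0"
| "co1 0 = 0"
| "co2 0 = 0"
| "co3 0 = 0"
| "co23 0 = 0"
| "co31 0 = 0"
| "co12 0 = 0"
| "co123 0 = 0"

primcorec one_cl3 where
  "co0 1 = 1"
| "co1 1 = 0"
| "co2 1 = 0"
| "co3 1 = 0"
| "co23 1 = 0"
| "co31 1 = 0"
| "co12 1 = 0"
| "co123 1 = 0"

primcorec plus_cl3 where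
  "co0 (x + y) = co0 x + co0 y"
| "co1 (x + y) = co1 x + co1 y"
| "co2 (x + y) = co2 x + co2 y"
| "co3 (x + y) = co3 x + co3 y"
| "co23 (x + y) = co23 x + co23 y"
| "co31 (x + y) = co31 x + co31 y"
| "co12 (x + y) = co12 x + co12 y"
| "co123 (x + y) = co123 x + co123 y"

primcorec minus_cl3 where
  "co0 (x - y) = co0 x - co0 y"
| "co1 (x - y) = co1 x - co1 y"
| "co2 (x - y) = co2 x - co2 y"
| "co3 (x - y) = co3 x - co3 y"
| "co23 (x - y) = co23 x - co23 y"
| "co31 (x - y) = co31 x - co31 y"
| "co12 (x - y) = co12 x - co12 y"
| "co123 (x - y) = co123 x - co123 y"

primcorec uminus_cl3 where
  "co0 (- x) = - co0 x"
| "co1 (- x) = - co1 x"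
| "co2 (- x) = - co2 x"
| "co3 (- x) = - co3 x"
| "co23 (- x) = - co23 x"
| "co31 (- x) = - co31 x"
| "co12 (- x) = - co12 x"
| "co123 (- x) = - co123 x"

primcorec scaleR_cl3 where
  "co0 (r *\<^sub>R x) = r * co0 x"
| "co1 (r *\<^sub>R x) = r * co1 x"
| "co2 (r *\<^sub>R x) = r * co2 x"
| "co3 (r *\<^sub>R x) = r * co3 x"
| "co23 (r *\<^sub>R x) = r * co23 x"
| "co31 (r *\<^sub>R x) = r * co31 x"
| "co12 (r *\<^sub>R x) = r * co12 x"
| "co123 (r *\<^sub>R x) = r * co123 x"

primcorec times_cl3 where
  "co0 (x * y) =
       co0 x * co0 y + co1 x * co1 y + co2 x * co2 y + co3 x * co3 y
       - co23 x * co23 y - co31 x * co31 y - co12 x * co12 y - co123 x * co123 y"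
| "co1 (x * y) =
       co0 x * co1 y + co1 x * co0 y - co2 x * co12 y + co3 x * co31 y
       - co31 x * co3 y + co12 x * co2 y - co23 x * co123 y - co123 x * co23 y"
| "co2 (x * y) =
       co0 x * co2 y + co2 x * co0 y - co3 x * co23 y + co1 x * co12 y
       - co12 x * co1 y + co23 x * co3 y - co31 x * co123 y - co123 x * co31 y"
| "co3 (x * y) =
       co0 x * co3 y + co3 x * co0 y - co1 x * co31 y + co2 x * co23 y
       - co23 x * co2 y + co31 x * co1 y - co12 x * co123 y - co123 x * co12 y"
| "co23 (x * y) =
       co0 x * co23 y + co23 x * co0 y + co2 x * co3 y - co3 x * co2 y
       - co31 x * co12 y + co12 x * co31 y + co1 x * co123 y + co123 x * co1 y"
| "co31 (x * y) =
       co0 x * co31 y + co31 x * co0 y + co3 x * co1 y - co1 x * co3 y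
       - co12 x * co23 y + co23 x * co12 y + co2 x * co123 y + co123 x * co2 y"
| "co12 (x * y) =
       co0 x * co12 y + co12 x * co0 y + co1 x * co2 y - co2 x * co1 y
       - co23 x * co31 y + co31 x * co23 y + co3 x * co123 y + co123 x * co3 y"
| "co123 (x * y) =
       co0 x * co123 y + co123 x * co0 y + co1 x * co23 y + co23 x * co1 y
       + co2 x * co31 y + co31 x * co2 y + co3 x * co12 y + co12 x * co3 y"

instance
  by standard (simp_all add: cl3_eq_iff algebra_simps)

end

definition e1 :: cl3 where "e1 = Cl3 0 1 0 0 0 0 0 0"
definition e2 :: cl3 where "e2 = Cl3 0 0 1 0 0 0 0 0"
definition e3 :: cl3 where "e3 = Cl3 0 0 0 1 0 0 0 0"

lemma cl3_generators:
  "e1 * e1 = 1" "e2 * e2 = 1" "e3 * e3 = 1"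
  "e1 * e2 = - (e2 * e1)" "e2 * e3 = - (e3 * e2)" "e1 * e3 = - (e3 * e1)"
  by (simp_all add: e1_def e2_def e3_def cl3_eq_iff)

lemma cl3_expand:
  "Cl3 a0 a1 a2 a3 b1 b2 b3 p =
     a0 *\<^sub>R 1 + a1 *\<^sub>R e1 + a2 *\<^sub>R e2 + a3 *\<^sub>R e3
     + b1 *\<^sub>R (e2 * e3) + b2 *\<^sub>R (e3 * e1) + b3 *\<^sub>R (e1 * e2) + p *\<^sub>R (e1 * e2 * e3)"
  by (simp add: e1_def e2_def e3_def cl3_eq_iff)

definition cl3_vec :: "real^3 \<Rightarrow> cl3" where
  "cl3_vec v = (v $ 1) *\<^sub>R e1 + (v $ 2) *\<^sub>R e2 + (v $ 3) *\<^sub>R e3"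

lemma cl3_vec_square: "cl3_vec v * cl3_vec v = (v \<bullet> v) *\<^sub>R 1"
  by (simp add: cl3_vec_def e1_def e2_def e3_def cl3_eq_iff inner_vec_def sum_3)

text \<open>Reversal changes the sign of the components of grade 2 and 3. By the following lemma it is
  the linear anti-automorphism that fixes all vectors.\<close>

definition cl3_reverse :: "cl3 \<Rightarrow> cl3" where
  "cl3_reverse x =
     Cl3 (co0 x) (co1 x) (co2 x) (co3 x) (- co23 x) (- co31 x) (- co12 x) (- co123 x)"

lemma cl3_reverse_antiautomorphism:
  "cl3_reverse (x + y) = cl3_reverse x + cl3_reverse y"
  "cl3_reverse (r *\<^sub>R x) = r *\<^sub>R cl3_reverse x"
  "cl3_reverse 1 = 1"
  "cl3_reverse (x * y) = cl3_reverse y * cl3_reverse x"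
  "cl3_reverse (cl3_vec v) = cl3_vec v"
  by (simp_all add: cl3_reverse_def cl3_eq_iff cl3_vec_def e1_def e2_def e3_def algebra_simps)

section \<open>Spinors\<close>

definition spinors :: "cl3 set" where
  "spinors = {a0 *\<^sub>R 1 + a1 *\<^sub>R (e2 * e3) + a2 *\<^sub>R (e3 * e1) + a3 *\<^sub>R (e1 * e2) | a0 a1 a2 a3. True}"

text \<open>The expression \<open>(R\<^sub>1 R\<^sub>2\<^sup>~ + R\<^sub>2 R\<^sub>1\<^sup>~) / 2\<close> is a multivector; for spinors it is a scalar, so that
  taking the scalar coordinate loses nothing.\<close>

definition spinor_inner :: "cl3 \<Rightarrow> cl3 \<Rightarrow> real" where
  "spinor_inner R S = co0 ((1/2) *\<^sub>R (R * cl3_reverse S + S * cl3_reverse R))"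

lemma spinor_inner_scalar:
  assumes "R \<in> spinors" "S \<in> spinors"
  shows "(1/2) *\<^sub>R (R * cl3_reverse S + S * cl3_reverse R) = of_real (spinor_inner R S)"
  using assms
  by (auto simp: spinors_def spinor_inner_def cl3_reverse_def of_real_def
      cl3_eq_iff e1_def e2_def e3_def algebra_simps)

text \<open>The empty product \<open>1\<close> is included.\<close>

definition even_products :: "(real^3) set \<Rightarrow> cl3 set" where
  "even_products \<Phi> = {prod_list (map cl3_vec \<alpha>s) | \<alpha>s. set \<alpha>s \<subseteq> \<Phi> \<and> even (length \<alpha>s)}"

definition spinor_group :: "(real^3) set \<Rightarrow> cl3 monoid" where
  "spinor_group \<Phi> = \<lparr>carrier = even_products \<Phi>, mult = (*), one = 1\<rparr>"

end

theory Submission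
  imports Defs
begin

text \<open>Let \<open>G\<close> be the set of even products of roots, all roots being unit vectors. A unit vector
  squares to \<open>1\<close> in the Clifford algebra, so reversing the factors of a product inverts it: every
  \<open>R \<in> G\<close> satisfies \<open>R R\<^sup>~ = R\<^sup>~ R = 1\<close>, and \<open>R\<^sup>~\<close> again lies in \<open>G\<close>. Hence \<open>G\<close> is a group and
  consists of unit spinors. It contains \<open>-1 = \<alpha> (-\<alpha>)\<close>, because the negative of a root is a root;
  so \<open>G\<close> is closed under negation, and two elements of \<open>G\<close> on one line differ at most in sign.

  The reflection of spinors needs no case analysis. Since \<open>R\<close> is a unit spinor and
  \<open>2 (S, R) = S R\<^sup>~ + R S\<^sup>~\<close>,
  \<open>S - 2 (S, R) R = S - S R\<^sup>~ R - R S\<^sup>~ R = - R S\<^sup>~ R\<close>,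
  which lies in \<open>G\<close> for all \<open>R, S \<in> G\<close> (lemma \<open>spinor_reflection\<close>).

  Finally \<open>G\<close> spans the spinors: the geometric product is bilinear and the roots span the vectors,
  so the span of the products of two roots contains all products of two vectors, in particular the
  basis \<open>1, e\<^sub>2e\<^sub>3, e\<^sub>3e\<^sub>1, e\<^sub>1e\<^sub>2\<close> (lemma \<open>span_even_products\<close>).\<close>

section \<open>The Euclidean space of spinors\<close>

lemma spinors_iff: "x \<in> spinors \<longleftrightarrow> co1 x = 0 \<and> co2 x = 0 \<and> co3 x = 0 \<and> co123 x = 0"
proof
  assume "co1 x = 0 \<and> co2 x = 0 \<and> co3 x = 0 \<and> co123 x = 0"
  then have "x = co0 x *\<^sub>R 1 + co23 x *\<^sub>R (e2 * e3) + co31 x *\<^sub>R (e3 * e1) + co12 x *\<^sub>R (e1 * e2)"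
    by (simp add: cl3_eq_iff e1_def e2_def e3_def)
  then show "x \<in> spinors"
    unfolding spinors_def by blast
qed (auto simp: spinors_def e1_def e2_def e3_def)

lemma subspace_spinors: "subspace spinors"
  by (simp add: subspace_def spinors_iff)

lemma mult_in_spinors: "x \<in> spinors \<Longrightarrow> y \<in> spinors \<Longrightarrow> x * y \<in> spinors"
  by (simp add: spinors_iff)

lemma vec_mult_vec_in_spinors: "cl3_vec v * cl3_vec w \<in> spinors"
  by (simp add: spinors_iff cl3_vec_def e1_def e2_def e3_def)

definition spinor_basis :: "cl3 set" where
  "spinor_basis = {1, e2 * e3, e3 * e1, e1 * e2}"

lemma spinor_basis_distinct:
  "1 \<noteq> e2 * e3" "1 \<noteq> e3 * e1" "1 \<noteq> e1 * e2"
  "e2 * e3 \<noteq> e3 * e1" "e2 * e3 \<noteq> e1 * e2" "e3 * e1 \<noteq> e1 * e2"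
  by (simp_all add: cl3_eq_iff e1_def e2_def e3_def)

lemma card_spinor_basis: "card spinor_basis = 4"
  using spinor_basis_distinct by (simp add: spinor_basis_def)

lemma independent_spinor_basis: "independent spinor_basis"
proof (rule independent_if_scalars_zero)
  show "finite spinor_basis"
    by (simp add: spinor_basis_def)
next
  fix f x
  assume *: "(\<Sum>x\<in>spinor_basis. f x *\<^sub>R x) = 0" and x: "x \<in> spinor_basis"
  have "f 1 *\<^sub>R 1 + (f (e2 * e3) *\<^sub>R (e2 * e3) + (f (e3 * e1) *\<^sub>R (e3 * e1)
      + f (e1 * e2) *\<^sub>R (e1 * e2))) = 0"
    using * spinor_basis_distinct by (simp add: spinor_basis_def)
  then have "f 1 = 0 \<and> f (e2 * e3) = 0 \<and> f (e3 * e1) = 0 \<and> f (e1 * e2) = 0"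
    by (simp add: cl3_eq_iff[of _ 0]) (simp add: e1_def e2_def e3_def)
  then show "f x = 0"
    using x by (auto simp: spinor_basis_def)
qed

lemma span_spinor_basis: "span spinor_basis = spinors"
proof
  show "span spinor_basis \<subseteq> spinors"
    by (rule span_minimal[OF _ subspace_spinors])
      (auto simp: spinor_basis_def spinors_iff e1_def e2_def e3_def)
  show "spinors \<subseteq> span spinor_basis"
    by (auto simp: spinors_def spinor_basis_def intro!: span_add span_scale intro: span_base)
qed

lemma spinor_inner_self:
  assumes "x \<in> spinors"
  shows "spinor_inner x x = (co0 x)\<^sup>2 + (co23 x)\<^sup>2 + (co31 x)\<^sup>2 + (co12 x)\<^sup>2"
  using assms by (simp add: spinor_inner_def cl3_reverse_def spinors_iff power2_eq_square)

lemma spinor_inner_pos: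
  assumes "x \<in> spinors" "x \<noteq> 0"
  shows "spinor_inner x x > 0"
proof -
  have "co0 x \<noteq> 0 \<or> co23 x \<noteq> 0 \<or> co31 x \<noteq> 0 \<or> co12 x \<noteq> 0"
    using assms by (auto simp: spinors_iff cl3_eq_iff)
  then have "0 < (co0 x)\<^sup>2 \<or> 0 < (co23 x)\<^sup>2 \<or> 0 < (co31 x)\<^sup>2 \<or> 0 < (co12 x)\<^sup>2"
    by simp
  then show ?thesis
    unfolding spinor_inner_self[OF assms(1)]
    using zero_le_power2[of "co0 x"] zero_le_power2[of "co23 x"]
      zero_le_power2[of "co31 x"] zero_le_power2[of "co12 x"]
    by linarith
qed

lemma spinor_inner_unit: "x * cl3_reverse x = 1 \<Longrightarrow> spinor_inner x x = 1"
  by (simp add: spinor_inner_def del: one_add_one)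

lemma spinor_inner_scale: "spinor_inner (c *\<^sub>R x) y = c * spinor_inner x y"
  "spinor_inner x (c *\<^sub>R y) = c * spinor_inner x y"
  by (simp_all add: spinor_inner_def cl3_reverse_antiautomorphism algebra_simps)

lemma euclidean_form_on_spinors: "euclidean_form_on 4 spinors spinor_inner"
proof -
  have basis: "\<exists>b. finite b \<and> independent b \<and> card b = 4 \<and> span b = spinors"
    using card_spinor_basis independent_spinor_basis span_spinor_basis
    by (intro exI[of _ spinor_basis]) (simp add: spinor_basis_def)
  have add: "spinor_inner (x + y) z = spinor_inner x z + spinor_inner y z" for x y z
    by (simp add: spinor_inner_def cl3_reverse_antiautomorphism algebra_simps)
  have sym: "spinor_inner x y = spinor_inner y x" for x y
    by (simp add: spinor_inner_def add.commute)
  show ?thesis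
    unfolding euclidean_form_on_def
    by (intro conjI ballI allI impI basis add sym spinor_inner_scale(1) spinor_inner_pos)
qed

text \<open>Both terms of \<open>2 (S, R) R = (S R\<^sup>~ + R S\<^sup>~) R\<close> simplify by \<open>R\<^sup>~ R = 1\<close>; the first one
  cancels \<open>S\<close>.\<close>

lemma spinor_reflection:
  assumes R: "R \<in> spinors" and S: "S \<in> spinors"
    and unit: "R * cl3_reverse R = 1" "cl3_reverse R * R = 1"
  shows "root_reflection spinor_inner R S = - (R * cl3_reverse S * R)"
proof -
  have norm_R: "spinor_inner R R = 1"
    by (rule spinor_inner_unit[OF unit(1)])
  have "(2 * spinor_inner S R) *\<^sub>R R = 2 *\<^sub>R (of_real (spinor_inner S R) * R)"
    by (simp add: of_real_def)
  also have "\<dots> = 2 *\<^sub>R (((1/2) *\<^sub>R (S * cl3_reverse R + R * cl3_reverse S)) * R)"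
    by (simp only: spinor_inner_scalar[OF S R])
  also have "\<dots> = S * (cl3_reverse R * R) + R * cl3_reverse S * R"
    by (simp add: distrib_right mult.assoc)
  also have "\<dots> = S + R * cl3_reverse S * R"
    by (simp add: unit)
  finally show ?thesis
    by (simp add: root_reflection_def norm_R)
qed

section \<open>Even products of vectors\<close>

lemma cl3_reverse_involution: "cl3_reverse (cl3_reverse x) = x"
  by (simp add: cl3_reverse_def cl3_eq_iff)

lemma one_in_even_products: "1 \<in> even_products \<Phi>"
  unfolding even_products_def by (force intro: exI[of _ "[]"])

lemma vec_mult_vec_in_even_products:
  assumes "\<alpha> \<in> \<Phi>" "\<beta> \<in> \<Phi>"
  shows "cl3_vec \<alpha> * cl3_vec \<beta> \<in> even_products \<Phi>"
  unfolding even_products_def using assms by (force intro: exI[of _ "[\<alpha>, \<beta>]"])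

lemma mult_in_even_products:
  assumes "x \<in> even_products \<Phi>" "y \<in> even_products \<Phi>"
  shows "x * y \<in> even_products \<Phi>"
proof -
  obtain as bs where
    "x = prod_list (map cl3_vec as)" "set as \<subseteq> \<Phi>" "even (length as)"
    "y = prod_list (map cl3_vec bs)" "set bs \<subseteq> \<Phi>" "even (length bs)"
    using assms unfolding even_products_def by blast
  then have "x * y = prod_list (map cl3_vec (as @ bs)) \<and> set (as @ bs) \<subseteq> \<Phi>
      \<and> even (length (as @ bs))"
    by simp
  then show ?thesis
    unfolding even_products_def by blast
qed

text \<open>Peeling off the factors in pairs keeps every intermediate product even, so that a property
  of even products never has to be extended to odd ones.\<close>

lemma even_products_induct [consumes 1, case_names one mult]:
  assumes "x \<in> even_products \<Phi>"
    and one: "P 1"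
    and mult: "\<And>\<alpha> \<beta> x. \<alpha> \<in> \<Phi> \<Longrightarrow> \<beta> \<in> \<Phi> \<Longrightarrow> P x \<Longrightarrow> P (cl3_vec \<alpha> * cl3_vec \<beta> * x)"
  shows "P x"
proof -
  have "P (prod_list (map cl3_vec as))" if "set as \<subseteq> \<Phi>" "even (length as)" for as
    using that
    by (induction as rule: induct_list012) (auto simp: one mult mult.assoc[symmetric])
  then show ?thesis
    using assms(1) unfolding even_products_def by blast
qed

lemma even_products_in_spinors: "x \<in> even_products \<Phi> \<Longrightarrow> x \<in> spinors"
  by (induction rule: even_products_induct)
    (auto intro: mult_in_spinors vec_mult_vec_in_spinors simp: spinors_iff[of 1])

lemma reverse_in_even_products: "x \<in> even_products \<Phi> \<Longrightarrow> cl3_reverse x \<in> even_products \<Phi>"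
  by (induction rule: even_products_induct)
    (auto simp: cl3_reverse_antiautomorphism
      intro: one_in_even_products mult_in_even_products vec_mult_vec_in_even_products)

lemma unit_vec_square: "norm v = 1 \<Longrightarrow> cl3_vec v * cl3_vec v = 1"
  by (simp add: cl3_vec_square norm_eq_1)

lemma even_products_unit:
  assumes "x \<in> even_products \<Phi>" and unit: "\<forall>\<alpha>\<in>\<Phi>. norm \<alpha> = 1"
  shows "x * cl3_reverse x = 1"
  using assms(1)
proof (induction rule: even_products_induct)
  case one
  then show ?case
    by (simp add: cl3_reverse_antiautomorphism)
next
  case (mult \<alpha> \<beta> x)
  have "cl3_vec \<alpha> * cl3_vec \<beta> * x * cl3_reverse (cl3_vec \<alpha> * cl3_vec \<beta> * x)
      = cl3_vec \<alpha> * (cl3_vec \<beta> * (x * cl3_reverse x) * cl3_vec \<beta>) * cl3_vec \<alpha>"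
    by (simp add: cl3_reverse_antiautomorphism mult.assoc)
  then show ?case
    using mult unit by (simp add: unit_vec_square)
qed

lemma even_products_unit':
  assumes "x \<in> even_products \<Phi>" "\<forall>\<alpha>\<in>\<Phi>. norm \<alpha> = 1"
  shows "cl3_reverse x * x = 1"
  using even_products_unit[OF reverse_in_even_products[OF assms(1)] assms(2)]
  by (simp add: cl3_reverse_involution)

lemma group_spinor_group:
  assumes "\<forall>\<alpha>\<in>\<Phi>. norm \<alpha> = 1"
  shows "group (spinor_group \<Phi>)"
proof (rule groupI)
  fix x assume "x \<in> carrier (spinor_group \<Phi>)"
  then show "\<exists>y\<in>carrier (spinor_group \<Phi>). y \<otimes>\<^bsub>spinor_group \<Phi>\<^esub> x = \<one>\<^bsub>spinor_group \<Phi>\<^esub>"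
    using reverse_in_even_products even_products_unit'[OF _ assms]
    by (auto simp: spinor_group_def)
qed (auto simp: spinor_group_def mult.assoc
    intro: one_in_even_products mult_in_even_products)

text \<open>For a fixed left factor the right factors whose product lies in the span of \<open>G\<close> form a
  subspace; it contains \<open>\<Phi>\<close> and hence everything. The same argument applied afterwards to the left
  factor replaces both roots by arbitrary vectors.\<close>

lemma span_even_products:
  assumes "span \<Phi> = UNIV"
  shows "span (even_products \<Phi>) = spinors"
proof
  let ?W = "span (even_products \<Phi>)"
  show "?W \<subseteq> spinors"
    by (rule span_minimal[OF _ subspace_spinors]) (auto intro: even_products_in_spinors)
  have cl3_vec_linear: "cl3_vec 0 = 0" "cl3_vec (v + w) = cl3_vec v + cl3_vec w"
    "cl3_vec (c *\<^sub>R v) = c *\<^sub>R cl3_vec v" for v w c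
    by (simp_all add: cl3_vec_def algebra_simps)
  have right: "cl3_vec \<alpha> * cl3_vec w \<in> ?W" if "\<alpha> \<in> \<Phi>" for \<alpha> w
  proof -
    have "subspace {w. cl3_vec \<alpha> * cl3_vec w \<in> ?W}"
      by (auto simp: subspace_def cl3_vec_linear distrib_left
          intro: span_zero span_add span_scale)
    moreover have "\<Phi> \<subseteq> {w. cl3_vec \<alpha> * cl3_vec w \<in> ?W}"
      using that by (auto intro: span_base vec_mult_vec_in_even_products)
    ultimately show ?thesis
      using span_minimal[of \<Phi>] assms by blast
  qed
  have products: "cl3_vec v * cl3_vec w \<in> ?W" for v w
  proof -
    have "subspace {v. cl3_vec v * cl3_vec w \<in> ?W}"
      by (auto simp: subspace_def cl3_vec_linear distrib_right
          intro: span_zero span_add span_scale)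
    moreover have "\<Phi> \<subseteq> {v. cl3_vec v * cl3_vec w \<in> ?W}"
      using right by auto
    ultimately show ?thesis
      using span_minimal[of \<Phi>] assms by blast
  qed
  have "cl3_vec (axis 1 1) = e1" "cl3_vec (axis 2 1) = e2" "cl3_vec (axis 3 1) = e3"
    by (simp_all add: cl3_vec_def axis_def)
  then have "e2 * e3 \<in> ?W" "e3 * e1 \<in> ?W" "e1 * e2 \<in> ?W"
    using products by metis+
  then show "spinors \<subseteq> ?W"
    using span_base[OF one_in_even_products[of \<Phi>]]
    by (auto simp: spinors_def intro!: span_add span_scale)
qed

section \<open>The spinor group is a root system\<close>

lemma uminus_in_even_products:
  assumes "\<alpha> \<in> \<Phi>" "- \<alpha> \<in> \<Phi>" "norm \<alpha> = 1" and x: "x \<in> even_products \<Phi>"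
  shows "- x \<in> even_products \<Phi>"
proof -
  have "cl3_vec \<alpha> * cl3_vec (- \<alpha>) = - (cl3_vec \<alpha> * cl3_vec \<alpha>)"
    by (simp add: cl3_vec_def algebra_simps)
  then have "cl3_vec \<alpha> * cl3_vec (- \<alpha>) * x = - x"
    using unit_vec_square assms(3) by simp
  then show ?thesis
    using mult_in_even_products[OF vec_mult_vec_in_even_products[OF assms(1,2)] x] by simp
qed

theorem theorem3p2:
  fixes \<Phi> :: "(real^3) set"
  assumes "root_system 3 UNIV (\<bullet>) \<Phi>"
    and "\<forall>\<alpha>\<in>\<Phi>. norm \<alpha> = 1"
  shows "group (spinor_group \<Phi>) \<and>
    root_system 4 spinors spinor_inner (carrier (spinor_group \<Phi>))"
proof
  show "group (spinor_group \<Phi>)"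
    by (rule group_spinor_group[OF assms(2)])
  let ?G = "even_products \<Phi>"
  have span: "span \<Phi> = UNIV"
    and line: "\<And>\<alpha>. \<alpha> \<in> \<Phi> \<Longrightarrow> \<Phi> \<inter> range (\<lambda>c. c *\<^sub>R \<alpha>) = {\<alpha>, - \<alpha>}"
    using assms(1) by (auto simp: root_system_def)
  have "\<Phi> \<noteq> {}"
  proof
    assume "\<Phi> = {}"
    then have "(UNIV :: (real^3) set) = {0}"
      using span by simp
    then have "axis 1 1 = (0 :: real^3)"
      by blast
    then show False
      by simp
  qed
  then obtain \<alpha> where "\<alpha> \<in> \<Phi>" "- \<alpha> \<in> \<Phi>"
    using line by blast
  then have neg: "- x \<in> ?G" if "x \<in> ?G" for x
    using uminus_in_even_products assms(2) that by blast
  have inner_1: "spinor_inner x x = 1" if "x \<in> ?G" for x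
    by (rule spinor_inner_unit[OF even_products_unit[OF that assms(2)]])
  have "0 \<notin> ?G"
    using even_products_unit[OF _ assms(2), of 0] by auto
  moreover have "?G \<inter> range (\<lambda>c. c *\<^sub>R R) = {R, - R}" if R: "R \<in> ?G" for R
  proof
    show "?G \<inter> range (\<lambda>c. c *\<^sub>R R) \<subseteq> {R, - R}"
    proof
      fix x assume "x \<in> ?G \<inter> range (\<lambda>c. c *\<^sub>R R)"
      then obtain c where x: "x \<in> ?G" "x = c *\<^sub>R R"
        by blast
      then have "c * c = 1"
        using inner_1[OF x(1)] inner_1[OF R] by (simp add: spinor_inner_scale)
      then show "x \<in> {R, - R}"
        using x(2) by (auto simp: square_eq_1_iff)
    qed
    have "R = 1 *\<^sub>R R" "- R = (- 1) *\<^sub>R R"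
      by simp_all
    then show "{R, - R} \<subseteq> ?G \<inter> range (\<lambda>c. c *\<^sub>R R)"
      using R neg by blast
  qed
  moreover have "root_reflection spinor_inner R ` ?G = ?G" if R: "R \<in> ?G" for R
  proof -
    note unit = even_products_unit[OF R assms(2)] even_products_unit'[OF R assms(2)]
    have refl: "root_reflection spinor_inner R S = - (R * cl3_reverse S * R)" if "S \<in> ?G" for S
      using spinor_reflection[OF _ _ unit] even_products_in_spinors R that by blast
    have closed: "- (R * cl3_reverse S * R) \<in> ?G" if "S \<in> ?G" for S
      using R that by (intro neg mult_in_even_products reverse_in_even_products)
    \<comment> \<open>The map \<open>S \<mapsto> - R S\<^sup>~ R\<close> is an involution, so \<open>S\<close> is the image of its own image.\<close>
    have "S \<in> root_reflection spinor_inner R ` ?G" if S: "S \<in> ?G" for S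
    proof -
      let ?T = "- (R * cl3_reverse S * R)"
      have "cl3_reverse ?T = - (cl3_reverse R * S * cl3_reverse R)"
        using cl3_reverse_antiautomorphism(2)[of "-1"]
        by (simp add: cl3_reverse_antiautomorphism(4) cl3_reverse_involution mult.assoc)
      then have "- (R * cl3_reverse ?T * R)
          = (R * cl3_reverse R) * S * (cl3_reverse R * R)"
        by (simp add: mult.assoc)
      then have "S = root_reflection spinor_inner R ?T"
        using refl[OF closed[OF S]] by (simp add: unit)
      then show ?thesis
        using closed[OF S] by blast
    qed
    then show ?thesis
      using refl closed by auto
  qed
  ultimately have "root_system 4 spinors spinor_inner ?G"
    by (simp add: root_system_def euclidean_form_on_spinors span_even_products[OF span])
  then show "root_system 4 spinors spinor_inner (carrier (spinor_group \<Phi>))"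
    by (simp add: spinor_group_def)
qed

end
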